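(* Let $n\ge 2$, $k\ge 1$, and let $\bar X:\mathbb{R}^2\to\mathbb{R}^n$ be a conformal polynomial surface parameterization of degree $k$. Then $\bar X$ is harmonic, i.e. every component $X_l$ ($l=1,\dots,n$) satisfies $\Delta X_l=\partial_x^2X_l+\partial_y^2X_l=0$ on $\mathbb{R}^2$. Moreover, there exist vectors $\bar v_i,\bar w_i\in\mathbb{R}^n$, $0\le i\le k$, such that in polar coordinates $x=r\cos\theta$, $y=r\sin\theta$ $$\bar X=\sum_{i=0}^k r^i\left(\bar v_i\sin(i\theta)+\bar w_i\cos(i\theta)\right),$$ equivalently, in Cartesian coordinates with $z=x+\mathbf{i}y$ (where $\mathbf{i}$ is the imaginary unit), $$\bar X=\sum_{i=0}^k\left(\bar w_i\,\mathrm{Re}(z^i)+\bar v_i\,\mathrm{Im}(z^i)\right),$$ and the vector coefficients of maximum degree $j=k$ and of minimum degree $j=1$ satisfy $$|\bar v_j|=|\bar w_j|,\qquad \bar v_j\cdot\bar w_j=0 .$$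
   Context: A polynomial surface parameterization in $\mathbb{R}^n$ is a map $\bar X=(X_1,\dots,X_n):\mathbb{R}^2\to\mathbb{R}^n$, $(x,y)\mapsto\bar X(x,y)$, all of whose components are real polynomials in $x,y$; its degree is the maximum of the degrees of its components. It is called conformal if $\bar X_x\cdot\bar X_x-\bar X_y\cdot\bar X_y=0$ and $\bar X_x\cdot\bar X_y=0$ at every point of $\mathbb{R}^2$, where subscripts denote partial derivatives and $\cdot$ is the Euclidean inner product of $\mathbb{R}^n$. *)

theory Defs
  imports "HOL-Analysis.Analysis" "HOL-Computational_Algebra.Polynomial"
begin

text \<open>
  A bivariate polynomial is an element of \<^typ>\<open>real poly poly\<close>, read as a polynomial in \<open>y\<close> whose
  coefficients are polynomials in \<open>x\<close>: the coefficient of \<open>x ^ i * y ^ j\<close> in \<open>p\<close> is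
  \<open>coeff (coeff p j) i\<close>.
\<close>

definition bipoly :: "real poly poly \<Rightarrow> real \<times> real \<Rightarrow> real" where
  "bipoly p = (\<lambda>(x, y). poly (poly p [:y:]) x)"

lemma bipoly_add: "bipoly (p + q) z = bipoly p z + bipoly q z"
  by (simp add: bipoly_def split: prod.split)

lemma bipoly_monom: "bipoly (monom (monom c i) j) (x, y) = c * x ^ i * y ^ j"
  by (simp add: bipoly_def poly_monom poly_power)

definition total_degree :: "'a::zero poly poly \<Rightarrow> nat" where
  "total_degree p = Max (insert 0 {i + j |i j. coeff (coeff p j) i \<noteq> 0})"

lemma finite_total_degree: "finite {i + j |i j. coeff (coeff p j) i \<noteq> (0 :: 'a::zero)}"
proof (rule finite_subset)
  show "{i + j |i j. coeff (coeff p j) i \<noteq> 0} \<subseteq>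
          (\<Union>j\<le>degree p. (\<lambda>i. i + j) ` {..degree (coeff p j)})"
  proof
    fix m assume "m \<in> {i + j |i j. coeff (coeff p j) i \<noteq> 0}"
    then obtain i j where ij: "m = i + j" "coeff (coeff p j) i \<noteq> 0" by blast
    then have "coeff p j \<noteq> 0" by auto
    then have "j \<le> degree p" by (rule le_degree)
    moreover have "i \<le> degree (coeff p j)" using ij(2) by (rule le_degree)
    ultimately show "m \<in> (\<Union>j\<le>degree p. (\<lambda>i. i + j) ` {..degree (coeff p j)})"
      using ij(1) by blast
  qed
qed simp

text \<open>
  The polynomials \<open>P l\<close> are uniquely determined by \<open>X\<close>, so a polynomial surface has exactly one degree.
\<close>

definition polynomial_surface :: "nat \<Rightarrow> (real \<times> real \<Rightarrow> real ^ 'n) \<Rightarrow> bool" where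
  "polynomial_surface k X \<longleftrightarrow>
     (\<exists>P :: 'n \<Rightarrow> real poly poly.
        (\<forall>z l. X z $ l = bipoly (P l) z) \<and> k = Max (range (\<lambda>l. total_degree (P l))))"

definition partial_x :: "(real \<times> real \<Rightarrow> 'a::real_normed_vector) \<Rightarrow> real \<times> real \<Rightarrow> 'a" where
  "partial_x f = (\<lambda>(x, y). vector_derivative (\<lambda>t. f (t, y)) (at x))"

definition partial_y :: "(real \<times> real \<Rightarrow> 'a::real_normed_vector) \<Rightarrow> real \<times> real \<Rightarrow> 'a" where
  "partial_y f = (\<lambda>(x, y). vector_derivative (\<lambda>t. f (x, t)) (at y))"

definition conformal :: "(real \<times> real \<Rightarrow> 'a::real_inner) \<Rightarrow> bool" where
  "conformal X \<longleftrightarrow>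
     (\<forall>z. partial_x X z \<bullet> partial_x X z - partial_y X z \<bullet> partial_y X z = 0 \<and>
          partial_x X z \<bullet> partial_y X z = 0)"

definition laplacian :: "(real \<times> real \<Rightarrow> real) \<Rightarrow> real \<times> real \<Rightarrow> real" where
  "laplacian f z = partial_x (partial_x f) z + partial_y (partial_y f) z"

end

theory Submission
  imports Defs
begin

text \<open>
  Write each component as a polynomial in \<open>z\<close> and its conjugate, with coefficients
  \<open>c\<^sub>a\<^sub>b\<close>, where \<open>c\<^sub>b\<^sub>a\<close> is the conjugate of \<open>c\<^sub>a\<^sub>b\<close>. Conformality says that the complex bilinear
  square of \<open>\<partial>X/\<partial>z\<close> vanishes identically. If \<open>X\<close> is not harmonic, let \<open>K\<close> be the largest \<open>a + b\<close>
  with \<open>a, b \<ge> 1\<close> and \<open>c\<^sub>a\<^sub>b \<noteq> 0\<close>. In the square, the coefficient with exponents \<open>K - 2\<close> of \<open>z\<close> and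
  \<open>K\<close> of its conjugate only receives products of \<open>c\<^sub>a\<^sub>b\<close> with \<open>c\<^sub>b\<^sub>a\<close>, \<open>a + b = K\<close>: it is the sum
  of \<open>a b |c\<^sub>a\<^sub>b|\<^sup>2\<close>, which is positive, a contradiction. The conditions on the extreme vectors are the
  vanishing of the highest and lowest pure powers of \<open>z\<close> in the same square.
\<close>

section \<open>Polynomials in z and its conjugate, and their derivatives\<close>

definition zeval :: "complex poly poly \<Rightarrow> complex \<Rightarrow> complex" where
  "zeval F z = poly (poly F [:cnj z:]) z"

abbreviation coeff2 :: "'a::zero poly poly \<Rightarrow> nat \<Rightarrow> nat \<Rightarrow> 'a" where
  "coeff2 F a b \<equiv> coeff (coeff F b) a"

text \<open>The Wirtinger derivatives, taken formally: the inner variable stands for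
  \<open>z\<close> and the outer one for \<open>cnj z\<close>, so differentiation in
  \<open>z\<close> acts on each outer coefficient.\<close>

abbreviation dz :: "complex poly poly \<Rightarrow> complex poly poly" where
  "dz \<equiv> map_poly pderiv"

abbreviation dzbar :: "complex poly poly \<Rightarrow> complex poly poly" where
  "dzbar \<equiv> pderiv"

lemma zeval_0 [simp]: "zeval 0 z = 0"
  and zeval_add: "zeval (F + G) z = zeval F z + zeval G z"
  and zeval_diff: "zeval (F - G) z = zeval F z - zeval G z"
  and zeval_mult: "zeval (F * G) z = zeval F z * zeval G z"
  and zeval_power: "zeval (F ^ m) z = zeval F z ^ m"
  and zeval_sum: "zeval (\<Sum>i\<in>A. H i) z = (\<Sum>i\<in>A. zeval (H i) z)"
  and zeval_const: "zeval [:[:c:]:] z = c"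
  and zeval_smult: "zeval (smult [:c:] F) z = c * zeval F z"
  by (simp_all add: zeval_def poly_sum)

lemma zeval_pCons: "zeval (pCons p F) z = poly p z + cnj z * zeval F z"
  by (simp add: zeval_def)

text \<open>Restricted to a polynomial curve, \<open>F\<close> becomes a univariate polynomial;
  vanishing at all reals, it has infinitely many roots. This allows a real parameter to be replaced
  by a complex one.\<close>

lemma poly_line_zero:
  fixes F :: "complex poly poly"
  assumes "\<And>x::real. poly (poly F [:poly q (of_real x):]) (poly r (of_real x)) = 0"
  shows "poly (poly F [:poly q x:]) (poly r x) = 0"
proof -
  have "\<exists>G. \<forall>x. poly (poly F [:poly q x:]) (poly r x) = poly G x"
  proof (induction F)
    case 0
    show ?case by (rule exI[of _ 0]) simp
  next
    case (pCons p F)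
    then obtain G where "\<And>x. poly (poly F [:poly q x:]) (poly r x) = poly G x" by blast
    then show ?case
      \<comment> \<open>Horner's scheme: the head \<open>p\<close> is composed with
        \<open>r\<close>, and the tail is multiplied by the outer value \<open>q\<close>.\<close>
      by (intro exI[of _ "p \<circ>\<^sub>p r + q * G"]) (simp add: poly_pcompose)
  qed
  then obtain G where G: "\<And>x. poly (poly F [:poly q x:]) (poly r x) = poly G x" by blast
  have "range complex_of_real \<subseteq> {x. poly G x = 0}"
    using assms by (auto simp: G)
  moreover have "infinite (range complex_of_real)"
    by (simp add: finite_image_iff inj_on_def infinite_UNIV_char_0)
  ultimately have "G = 0"
    using poly_roots_finite finite_subset by blast
  then show ?thesis by (simp add: G)
qed

text \<open>
  The identity extends from real \<open>x, y\<close> to complex ones, one variable at a time; there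
  \<open>x + \<i> y\<close> and \<open>x - \<i> y\<close> are independent.
\<close>
lemma zeval_eq_0_imp_eq_0:
  assumes zero: "\<And>z. zeval F z = 0"
  shows "F = 0"
proof -
  have real_xy: "poly (poly F [:complex_of_real x - \<i> * of_real y:]) (of_real x + \<i> * of_real y) = 0"
    for x y
  proof -
    have "Complex x y = of_real x + \<i> * of_real y" "cnj (Complex x y) = of_real x - \<i> * of_real y"
      by (simp_all add: complex_eq_iff)
    then show ?thesis using zero[of "Complex x y"] by (simp only: zeval_def)
  qed
  have complex_x: "poly (poly F [:x - \<i> * of_real y:]) (x + \<i> * of_real y) = 0" for x y
  proof -
    have "poly [:- \<i> * of_real y, 1:] x = x - \<i> * of_real y"
      "poly [:\<i> * of_real y, 1:] x = x + \<i> * of_real y" for x by simp_all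
    then show ?thesis
      using poly_line_zero[of F "[:- \<i> * of_real y, 1:]" "[:\<i> * of_real y, 1:]" x] real_xy
      by (simp only:)
  qed
  have complex_xy: "poly (poly F [:x - \<i> * y:]) (x + \<i> * y) = 0" for x y
  proof -
    have "poly [:x, - \<i>:] y = x - \<i> * y" "poly [:x, \<i>:] y = x + \<i> * y" for y by simp_all
    then show ?thesis
      using poly_line_zero[of F "[:x, - \<i>:]" "[:x, \<i>:]" y] complex_x by (simp only:)
  qed
  have "poly (poly F [:v:]) u = 0" for u v
  proof -
    have "(u + v) / 2 - \<i> * ((u - v) / (2 * \<i>)) = v" "(u + v) / 2 + \<i> * ((u - v) / (2 * \<i>)) = u"
      by (simp_all add: field_simps)
    then show ?thesis using complex_xy[of "(u + v) / 2" "(u - v) / (2 * \<i>)"] by (simp only:)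
  qed
  then have "poly F [:v:] = 0" for v
    using poly_all_0_iff_0 by blast
  then have "range (\<lambda>v::complex. [:v:]) \<subseteq> {x. poly F x = 0}" by auto
  moreover have "infinite (range (\<lambda>v::complex. [:v:]))"
    by (simp add: finite_image_iff inj_on_def infinite_UNIV_char_0)
  ultimately show ?thesis
    using poly_roots_finite finite_subset by blast
qed

text \<open>Chain rule along a curve, by induction in Horner form. Conjugation is only real
  differentiable, so its share carries \<open>cnj d\<close>. The velocities \<open>1\<close> and
  \<open>\<i>\<close> will give the partial derivatives in x and y.\<close>

lemma zeval_has_vector_derivative:
  assumes "(\<gamma> has_vector_derivative d) (at t)"
  shows "((\<lambda>t. zeval F (\<gamma> t)) has_vector_derivative
           d * zeval (dz F) (\<gamma> t) + cnj d * zeval (dzbar F) (\<gamma> t)) (at t)"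
proof (induction F)
  case 0
  show ?case by simp
next
  case (pCons p F)
  have "((\<lambda>t. poly p (\<gamma> t)) has_vector_derivative d * poly (pderiv p) (\<gamma> t)) (at t)"
    using field_vector_diff_chain_at[OF assms poly_DERIV] by (simp add: o_def)
  then show ?case
    unfolding zeval_pCons
    by (rule has_vector_derivative_eq_rhs[OF has_vector_derivative_add[OF _
          has_vector_derivative_mult[OF has_vector_derivative_cnj[OF assms] pCons(2)]]])
       (simp add: map_poly_pCons pderiv_pCons zeval_pCons zeval_add algebra_simps)
qed

text \<open>The last two conclusions have the same form as the assumption, so the lemma can be
  applied again to obtain second derivatives. The first two record differentiability, from which the
  partial derivatives of the vector-valued surface are assembled.\<close>

lemma zeval_partial_derivatives:
  fixes f :: "real \<times> real \<Rightarrow> real"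
  assumes f: "\<And>x y. of_real (f (x, y)) = zeval F (Complex x y)"
  shows "((\<lambda>t. f (t, y)) has_vector_derivative partial_x f (x, y)) (at x)"
    and "((\<lambda>t. f (x, t)) has_vector_derivative partial_y f (x, y)) (at y)"
    and "of_real (partial_x f (x, y)) = zeval (dz F + dzbar F) (Complex x y)"
    and "of_real (partial_y f (x, y)) = zeval (smult [:\<i>:] (dz F - dzbar F)) (Complex x y)"
proof -
  \<comment> \<open>The imaginary part of a real-valued function is constantly 0, so its complex
    derivative is real.\<close>
  have real_derivative:
    "(g has_vector_derivative Re D) (at t) \<and> of_real (Re D) = D"
    if "((\<lambda>t. complex_of_real (g t)) has_vector_derivative D) (at t)" for g :: "real \<Rightarrow> real" and D t
  proof -
    have *: "(g has_vector_derivative Re D) (at t)" "((\<lambda>t. 0) has_vector_derivative Im D) (at t)"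
      using that
      by (auto simp: has_vector_derivative_complex_iff has_real_derivative_iff_has_vector_derivative)
    moreover have "Im D = 0"
      using vector_derivative_unique_at[OF *(2) has_vector_derivative_const] .
    ultimately show ?thesis by (simp add: complex_eq_iff)
  qed
  have "((\<lambda>t. Complex t y) has_vector_derivative 1) (at x)"
    by (auto simp: has_vector_derivative_complex_iff)
  from real_derivative[of "\<lambda>t. f (t, y)", unfolded f, OF zeval_has_vector_derivative[OF this, of F]]
  have x: "((\<lambda>t. f (t, y)) has_vector_derivative Re (zeval (dz F + dzbar F) (Complex x y))) (at x)"
    "of_real (Re (zeval (dz F + dzbar F) (Complex x y))) = zeval (dz F + dzbar F) (Complex x y)"
    by (simp_all add: zeval_add)
  then have xD: "partial_x f (x, y) = Re (zeval (dz F + dzbar F) (Complex x y))"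
    by (simp add: partial_x_def vector_derivative_at)
  have "((\<lambda>t. Complex x t) has_vector_derivative \<i>) (at y)"
    by (auto simp: has_vector_derivative_complex_iff)
  from real_derivative[of "\<lambda>t. f (x, t)", unfolded f, OF zeval_has_vector_derivative[OF this, of F]]
  have y: "((\<lambda>t. f (x, t)) has_vector_derivative
             Re (zeval (smult [:\<i>:] (dz F - dzbar F)) (Complex x y))) (at y)"
    "of_real (Re (zeval (smult [:\<i>:] (dz F - dzbar F)) (Complex x y)))
       = zeval (smult [:\<i>:] (dz F - dzbar F)) (Complex x y)"
    unfolding zeval_smult zeval_diff by (simp_all add: algebra_simps)
  then have yD: "partial_y f (x, y) = Re (zeval (smult [:\<i>:] (dz F - dzbar F)) (Complex x y))"
    by (simp add: partial_y_def vector_derivative_at)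
  show "((\<lambda>t. f (t, y)) has_vector_derivative partial_x f (x, y)) (at x)"
    and "((\<lambda>t. f (x, t)) has_vector_derivative partial_y f (x, y)) (at y)"
    and "of_real (partial_x f (x, y)) = zeval (dz F + dzbar F) (Complex x y)"
    and "of_real (partial_y f (x, y)) = zeval (smult [:\<i>:] (dz F - dzbar F)) (Complex x y)"
    using x y xD yD by simp_all
qed

lemma coeff2_dz: "coeff2 (dz F) a b = of_nat (Suc a) * coeff2 F (Suc a) b"
  by (simp add: coeff_map_poly coeff_pderiv)

lemma coeff2_dzbar: "coeff2 (dzbar F) a b = of_nat (Suc b) * coeff2 F a (Suc b)"
  by (simp add: coeff_pderiv of_nat_poly del: of_nat_Suc)

lemma dz_add: "dz (F + G) = dz F + dz G"
  and dz_diff: "dz (F - G) = dz F - dz G"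
  and dz_smult: "dz (smult [:c:] F) = smult [:c:] (dz F)"
  by (rule poly_eqI; simp add: coeff_map_poly pderiv_add pderiv_diff pderiv_smult)+

lemma dzbar_dz: "dzbar (dz F) = dz (dzbar F)"
  by (intro poly_eqI) (simp only: coeff2_dz coeff2_dzbar mult_ac)

text \<open>With the commuting operators A = \<open>dz\<close> and B = \<open>dzbar\<close>, the
  Laplacian is (A + B)^2 - (A - B)^2 = 4AB. Hence harmonicity means that the coefficients with both
  exponents positive vanish.\<close>

lemma laplacian_zeval:
  assumes "\<And>x y. of_real (f (x, y)) = zeval F (Complex x y)"
  shows "of_real (laplacian f (x, y)) = 4 * zeval (dz (dzbar F)) (Complex x y)"
proof -
  let ?X = "dz F + dzbar F" and ?Y = "smult [:\<i>:] (dz F - dzbar F)"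
  have eq: "zeval (dz ?X + dzbar ?X) z + zeval (smult [:\<i>:] (dz ?Y - dzbar ?Y)) z
      = 4 * zeval (dz (dzbar F)) z" for z
    unfolding dz_add dz_diff dz_smult pderiv_add pderiv_diff pderiv_smult dzbar_dz
      zeval_add zeval_diff zeval_smult
    by (simp add: complex_eq_iff)
  show ?thesis
    unfolding laplacian_def of_real_add
    by (subst zeval_partial_derivatives(3)[of "partial_x f" ?X],
        rule zeval_partial_derivatives(3)[OF assms],
        subst zeval_partial_derivatives(4)[of "partial_y f" ?Y],
        rule zeval_partial_derivatives(4)[OF assms], rule eq)
qed

section \<open>Degree bounds and the reality condition\<close>

definition degree_le :: "nat \<Rightarrow> complex poly poly \<Rightarrow> bool" where
  "degree_le k F \<longleftrightarrow> (\<forall>a b. coeff2 F a b \<noteq> 0 \<longrightarrow> a + b \<le> k)"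

lemma degree_leD: "degree_le k F \<Longrightarrow> coeff2 F a b \<noteq> 0 \<Longrightarrow> a + b \<le> k"
  by (simp add: degree_le_def)

lemma degree_le_trans: "degree_le k F \<Longrightarrow> k \<le> m \<Longrightarrow> degree_le m F"
  by (meson degree_le_def le_trans)

text \<open>Holds exactly when \<^const>\<open>zeval\<close> takes only real values.\<close>
definition hermitian :: "complex poly poly \<Rightarrow> bool" where
  "hermitian F \<longleftrightarrow> (\<forall>a b. cnj (coeff2 F a b) = coeff2 F b a)"

lemma coeff2_mult:
  "coeff2 (F * G) a b = (\<Sum>j\<le>b. \<Sum>i\<le>a. coeff2 F i j * coeff2 G (a - i) (b - j))"
  by (simp add: coeff_mult coeff_sum)

lemma degree_le_mult:
  assumes "degree_le k F" "degree_le m G"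
  shows "degree_le (k + m) (F * G)"
  unfolding degree_le_def
proof (intro allI impI)
  fix a b
  assume "coeff2 (F * G) a b \<noteq> 0"
  then obtain j where j: "j \<in> {..b}" "(\<Sum>i\<le>a. coeff2 F i j * coeff2 G (a - i) (b - j)) \<noteq> 0"
    unfolding coeff2_mult by (rule sum.not_neutral_contains_not_neutral)
  from j(2) obtain i where i: "i \<in> {..a}" "coeff2 F i j * coeff2 G (a - i) (b - j) \<noteq> 0"
    by (rule sum.not_neutral_contains_not_neutral)
  then have "coeff2 F i j \<noteq> 0" "coeff2 G (a - i) (b - j) \<noteq> 0" by auto
  then have "i + j \<le> k" "(a - i) + (b - j) \<le> m"
    using assms degree_leD by blast+
  then show "a + b \<le> k + m" using i(1) j(1) by simp
qed

text \<open>Conjugation swaps the two exponents in each factor, so the two convolution sums merely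
  exchange their order.\<close>

lemma hermitian_mult:
  assumes "hermitian F" "hermitian G"
  shows "hermitian (F * G)"
  unfolding hermitian_def
proof (intro allI)
  fix a b
  have "cnj (coeff2 (F * G) a b) = (\<Sum>j\<le>b. \<Sum>i\<le>a. coeff2 F j i * coeff2 G (b - j) (a - i))"
    unfolding coeff2_mult cnj_sum
    using assms by (intro sum.cong refl) (simp add: hermitian_def)
  also have "\<dots> = coeff2 (F * G) b a"
    unfolding coeff2_mult by (rule sum.swap)
  finally show "cnj (coeff2 (F * G) a b) = coeff2 (F * G) b a" .
qed

lemma degree_le_power:
  assumes "degree_le 1 F"
  shows "degree_le m (F ^ m)"
proof (induction m)
  case 0
  show ?case by (auto simp: degree_le_def of_bool_def split: if_splits)
next
  case (Suc m)
  then show ?case using degree_le_mult[OF assms Suc] by simp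
qed

lemma hermitian_power:
  assumes "hermitian F"
  shows "hermitian (F ^ m)"
proof (induction m)
  case 0
  show ?case by (auto simp: hermitian_def of_bool_def)
next
  case (Suc m)
  then show ?case using hermitian_mult[OF assms Suc] by simp
qed

lemma degree_le_sum:
  assumes "\<And>i. i \<in> A \<Longrightarrow> degree_le k (H i)"
  shows "degree_le k (\<Sum>i\<in>A. H i)"
  unfolding degree_le_def
proof (intro allI impI)
  fix a b
  assume "coeff2 (\<Sum>i\<in>A. H i) a b \<noteq> 0"
  then have "(\<Sum>i\<in>A. coeff2 (H i) a b) \<noteq> 0" by (simp add: coeff_sum)
  then obtain i where "i \<in> A" "coeff2 (H i) a b \<noteq> 0"
    by (rule sum.not_neutral_contains_not_neutral)
  then show "a + b \<le> k" using assms by (auto simp: degree_le_def)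
qed

lemma hermitian_sum:
  assumes "\<And>i. i \<in> A \<Longrightarrow> hermitian (H i)"
  shows "hermitian (\<Sum>i\<in>A. H i)"
  using assms by (simp add: hermitian_def coeff_sum)

section \<open>From x and y to z and its conjugate\<close>

lemma le_total_degree:
  assumes "coeff2 p a b \<noteq> 0"
  shows "a + b \<le> total_degree p"
  unfolding total_degree_def using assms finite_total_degree[of p]
  by (intro Max_ge) auto

text \<open>Both coordinates are hermitian linear forms in z and its conjugate. Substituting them
  keeps the degree bound and, the coefficients being real, the symmetry, as both properties pass to
  products and sums.\<close>

lemma bipoly_eq_zeval:
  obtains F where "\<And>x y. of_real (bipoly p (x, y)) = zeval F (Complex x y)"
    and "hermitian F" and "degree_le (total_degree p) F"
proof -
  \<comment> \<open>These encode x = (z + cnj z) / 2 and y = (z - cnj z) / (2i).\<close>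
  define XX YY :: "complex poly poly" where
    "XX = [:[:0, 1/2:], [:1/2:]:]" and "YY = [:[:0, - \<i>/2:], [:\<i>/2:]:]"
  have lin: "degree_le 1 XX" "degree_le 1 YY" "hermitian XX" "hermitian YY"
    unfolding degree_le_def hermitian_def XX_def YY_def
    by (auto simp: coeff_pCons split: nat.splits)
  have eval: "zeval XX (Complex x y) = of_real x" "zeval YY (Complex x y) = of_real y" for x y
    unfolding XX_def YY_def zeval_def by (simp_all add: complex_eq_iff)
  define T where "T i j = [:[:complex_of_real (coeff2 p i j):]:] * (XX ^ i * YY ^ j)" for i j
  define F where "F = (\<Sum>j\<le>degree p. \<Sum>i\<le>degree (coeff p j). T i j)"
  have "of_real (bipoly p (x, y)) = zeval F (Complex x y)" for x y
  proof -
    have "bipoly p (x, y) = poly (\<Sum>j\<le>degree p. coeff p j * [:y:] ^ j) x"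
      unfolding bipoly_def by (simp only: poly_altdef[of p] prod.case)
    also have "\<dots> = (\<Sum>j\<le>degree p. poly (coeff p j) x * y ^ j)"
      by (simp add: poly_sum poly_power)
    also have "\<dots> = (\<Sum>j\<le>degree p. \<Sum>i\<le>degree (coeff p j). coeff2 p i j * (x ^ i * y ^ j))"
      (is "_ = ?S")
      by (simp only: poly_altdef[of "coeff p j" x for j] sum_distrib_right mult.assoc)
    finally have "bipoly p (x, y) = ?S" .
    moreover have "complex_of_real ?S = zeval F (Complex x y)"
      unfolding F_def T_def zeval_sum zeval_mult zeval_power zeval_const eval by simp
    ultimately show ?thesis by simp
  qed
  moreover have "hermitian F"
    unfolding F_def T_def
    by (intro hermitian_sum hermitian_mult hermitian_power lin)
       (auto simp: hermitian_def coeff_pCons split: nat.splits)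
  moreover have "degree_le (total_degree p) (T i j)" for i j
  proof (cases "coeff2 p i j = 0")
    case True
    then show ?thesis by (simp add: T_def degree_le_def)
  next
    case False
    have "degree_le (0 + (i + j)) (T i j)"
      unfolding T_def
      by (intro degree_le_mult degree_le_power lin)
         (auto simp: degree_le_def coeff_pCons split: nat.splits)
    then show ?thesis
      unfolding add_0 by (rule degree_le_trans[OF _ le_total_degree[OF False]])
  qed
  then have "degree_le (total_degree p) F"
    unfolding F_def by (intro degree_le_sum)
  ultimately show thesis by (rule that)
qed

section \<open>Expansion in real and imaginary parts of powers of z\<close>

lemma zeval_eq_sum:
  assumes "degree_le k F"
  shows "zeval F z = (\<Sum>b\<le>k. \<Sum>a\<le>k. coeff2 F a b * z ^ a * cnj z ^ b)"
proof -
  have coeff_0: "coeff2 F a b = 0" if "k < a + b" for a b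
    using assms that by (auto simp: degree_le_def not_le[symmetric])
  have "degree F \<le> k"
    by (intro degree_le allI impI poly_eqI) (simp add: coeff_0)
  have "degree (coeff F b) \<le> k" for b
    by (intro degree_le allI impI) (simp add: coeff_0)
  have "zeval F z = zeval (\<Sum>b\<le>k. monom (\<Sum>a\<le>k. monom (coeff2 F a b) a) b) z"
    using \<open>degree F \<le> k\<close> \<open>\<And>b. degree (coeff F b) \<le> k\<close> by (simp add: poly_as_sum_of_monoms')
  also have "\<dots> = (\<Sum>b\<le>k. \<Sum>a\<le>k. coeff2 F a b * z ^ a * cnj z ^ b)"
    by (simp add: zeval_def poly_sum poly_monom poly_power sum_distrib_right)
  finally show ?thesis .
qed

text \<open>Only pure powers remain, and those of \<open>cnj z\<close> are conjugate to those of
  \<open>z\<close>. Each pair contributes 2 Re(c z^i) = 2 Re c Re(z^i) - 2 Im c Im(z^i). The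
  constant term is its own conjugate: it is real and occurs once, whence the separate case
  \<open>i = 0\<close>.\<close>

lemma zeval_harmonic:
  assumes "degree_le k F" "hermitian F"
    and harmonic: "\<And>a b. 1 \<le> a \<Longrightarrow> 1 \<le> b \<Longrightarrow> coeff2 F a b = 0"
  shows "zeval F z = of_real (\<Sum>i\<le>k.
    Re (z ^ i) * (if i = 0 then Re (coeff2 F 0 0) else 2 * Re (coeff2 F i 0)) +
    Im (z ^ i) * (if i = 0 then 0 else - 2 * Im (coeff2 F i 0)))"
proof -
  let ?g = "\<lambda>i. coeff2 F i 0 * z ^ i"
  have cnj_coeff: "coeff2 F 0 b = cnj (coeff2 F b 0)" for b
    using assms(2) by (auto simp: hermitian_def)
  have split: "{..k} = insert 0 {1..k}" by auto
  have row: "(\<Sum>a\<le>k. coeff2 F a b * z ^ a * cnj z ^ b) = cnj (?g b)" if "b \<in> {1..k}" for b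
  proof -
    have "(\<Sum>a\<in>{1..k}. coeff2 F a b * z ^ a * cnj z ^ b) = 0"
      using that by (intro sum.neutral) (simp add: harmonic)
    then show ?thesis by (simp add: split cnj_coeff)
  qed
  have real_0: "coeff2 F 0 0 = of_real (Re (coeff2 F 0 0))"
    using cnj_coeff[of 0] by (simp add: complex_eq_iff)
  have "zeval F z = (\<Sum>a\<le>k. ?g a) + (\<Sum>b\<in>{1..k}. cnj (?g b))"
    unfolding zeval_eq_sum[OF assms(1)]
    by (subst (1) split) (simp add: row del: complex_cnj_mult)
  also have "\<dots> = coeff2 F 0 0 + (\<Sum>i\<in>{1..k}. ?g i + cnj (?g i))"
    by (simp add: split sum.distrib)
  also have "\<dots> = of_real (Re (coeff2 F 0 0) + (\<Sum>i\<in>{1..k}. 2 * Re (?g i)))"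
    by (subst real_0) (simp only: complex_add_cnj of_real_add of_real_sum of_real_mult of_real_numeral)
  also have "Re (coeff2 F 0 0) + (\<Sum>i\<in>{1..k}. 2 * Re (?g i)) = (\<Sum>i\<le>k.
    Re (z ^ i) * (if i = 0 then Re (coeff2 F 0 0) else 2 * Re (coeff2 F i 0)) +
    Im (z ^ i) * (if i = 0 then 0 else - 2 * Im (coeff2 F i 0)))"
    unfolding split by (subst sum.insert) (auto intro!: sum.cong simp: algebra_simps)
  finally show ?thesis .
qed

section \<open>Comparison of coefficients in the isotropy identity\<close>

lemma coeff2_sum_dz_mult:
  "coeff2 (\<Sum>l\<in>A. dz (F l) * dz (F l)) a b =
    (\<Sum>l\<in>A. \<Sum>j\<le>b. \<Sum>i\<le>a.
       of_nat (Suc i * Suc (a - i)) * (coeff2 (F l) (Suc i) j * coeff2 (F l) (Suc (a - i)) (b - j)))"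
  unfolding coeff_sum coeff2_mult coeff2_dz of_nat_mult by (simp only: mult_ac)

lemma isotropic_imp_harmonic:
  fixes F :: "'n::finite \<Rightarrow> complex poly poly"
  assumes degree: "\<And>l. degree_le k (F l)" and herm: "\<And>l. hermitian (F l)"
    and isotropic: "(\<Sum>l\<in>UNIV. dz (F l) * dz (F l)) = 0"
    and "1 \<le> a" "1 \<le> b"
  shows "coeff2 (F l) a b = 0"
proof (rule ccontr)
  assume nonzero: "coeff2 (F l) a b \<noteq> 0"
  define S where "S = {a + b | l a b. 1 \<le> a \<and> 1 \<le> b \<and> coeff2 (F l) a b \<noteq> 0}"
  have "S \<subseteq> {..k}"
    using degree unfolding S_def degree_le_def by blast
  then have "finite S" using finite_subset by blast
  moreover have "a + b \<in> S" using nonzero assms by (auto simp: S_def)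
  ultimately have "Max S \<in> S" using Max_in by blast
  define K where "K = Max S"
  obtain l0 a0 b0 where K: "K = a0 + b0" "1 \<le> a0" "1 \<le> b0" "coeff2 (F l0) a0 b0 \<noteq> 0"
    using \<open>Max S \<in> S\<close> unfolding K_def S_def by blast
  have above: "coeff2 (F l) a b = 0" if "1 \<le> a" "1 \<le> b" "K < a + b" for l a b
  proof (rule ccontr)
    assume "coeff2 (F l) a b \<noteq> 0"
    then have "a + b \<in> S" using that by (auto simp: S_def)
    then have "a + b \<le> K" using \<open>finite S\<close> by (simp add: K_def)
    then show False using that by simp
  qed
  \<comment> \<open>The index pairs of the two factors in a summand have totals adding up to
    \<open>2 * K\<close>. If they are not both \<open>K\<close>, one exceeds \<open>K\<close> at a
    pair with positive entries, and \<open>above\<close> makes that factor 0. If both are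
    \<open>K\<close>, the second pair is the first one swapped, and \<open>herm\<close> turns the
    product into a squared modulus.\<close>
  define t where "t l j i =
    (if Suc i + j = K then real (Suc i * j) * (cmod (coeff2 (F l) (Suc i) j))\<^sup>2 else 0)" for l j i
  have term_eq: "of_nat (Suc i * Suc (K - 2 - i)) *
      (coeff2 (F l) (Suc i) j * coeff2 (F l) (Suc (K - 2 - i)) (K - j)) = complex_of_real (t l j i)"
    if "j \<le> K" "i \<le> K - 2" for l j i
  proof -
    have "2 \<le> K" using K by simp
    consider "j = 0" | "1 \<le> j" "K < Suc i + j" | "1 \<le> j" "Suc i + j = K" | "1 \<le> j" "Suc i + j < K"
      by linarith
    then show ?thesis
    proof cases
      case 1
      \<comment> \<open>The first factor is now a pure power, which \<open>K\<close> does not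
        control. Its partner has total \<open>2 * K - Suc i\<close>, which exceeds \<open>K\<close>
        because \<open>i\<close> is at most \<open>K - 2\<close>.\<close>
      then have "coeff2 (F l) (Suc (K - 2 - i)) (K - j) = 0"
        using \<open>2 \<le> K\<close> by (intro above) auto
      then show ?thesis using 1 \<open>2 \<le> K\<close> that by (simp add: t_def)
    next
      case 2
      then have "coeff2 (F l) (Suc i) j = 0" by (intro above) auto
      then show ?thesis using 2 by (simp add: t_def)
    next
      case 3
      then have "Suc (K - 2 - i) = j" "K - j = Suc i" by auto
      moreover have "coeff2 (F l) j (Suc i) = cnj (coeff2 (F l) (Suc i) j)"
        using herm by (auto simp: hermitian_def)
      ultimately show ?thesis
        using 3 by (simp add: t_def complex_norm_square[symmetric] del: of_nat_Suc of_real_power)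
    next
      case 4
      then have "coeff2 (F l) (Suc (K - 2 - i)) (K - j) = 0"
        using \<open>2 \<le> K\<close> by (intro above) auto
      then show ?thesis using 4 by (simp add: t_def)
    qed
  qed
  have "complex_of_real (\<Sum>l\<in>UNIV. \<Sum>j\<le>K. \<Sum>i\<le>K - 2. t l j i)
      = coeff2 (\<Sum>l\<in>UNIV. dz (F l) * dz (F l)) (K - 2) K"
    unfolding coeff2_sum_dz_mult of_real_sum
    by (intro sum.cong refl) (rule term_eq[symmetric], simp_all)
  also have "\<dots> = 0" by (simp add: isotropic)
  finally have "(\<Sum>l\<in>UNIV. \<Sum>j\<le>K. \<Sum>i\<le>K - 2. t l j i) = 0" by (simp only: of_real_eq_0_iff)
  moreover have "t l j i \<ge> 0" for l j i by (simp add: t_def)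
  \<comment> \<open>The first index is \<open>Suc i\<close>, so the nonzero coefficient at
    \<open>(a0, b0)\<close> sits at \<open>i = a0 - 1\<close>; this is within range because
    \<open>b0\<close> is at least 1.\<close>
  ultimately have "t l0 b0 (a0 - 1) = 0"
    using K by (simp add: sum_nonneg_eq_0_iff sum_nonneg)
  moreover have "t l0 b0 (a0 - 1) > 0" using K by (simp add: t_def)
  ultimately show False by simp
qed

text \<open>The coefficient of z^(2(j - 1)) in the square is a convolution of pure coefficients. For
  \<open>j = k\<close> every off-diagonal product has a factor of index above \<open>k\<close>; for
  \<open>j = 1\<close> there is only one product. What is left is j^2 times the sum of
  squares.\<close>

lemma isotropic_extreme_coeffs:
  fixes F :: "'n::finite \<Rightarrow> complex poly poly"
  assumes degree: "\<And>l. degree_le k (F l)"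
    and isotropic: "(\<Sum>l\<in>UNIV. dz (F l) * dz (F l)) = 0"
    and "1 \<le> k" "j \<in> {k, 1}"
  shows "(\<Sum>l\<in>UNIV. (coeff2 (F l) j 0)\<^sup>2) = 0"
proof -
  obtain n where j: "j = Suc n" using assms(3,4) by (cases j) auto
  define t where "t l i = complex_of_nat (Suc i * Suc (2 * n - i)) *
    (coeff2 (F l) (Suc i) 0 * coeff2 (F l) (Suc (2 * n - i)) 0)" for l i
  have off_diagonal: "t l i = 0" if "i \<le> 2 * n" "i \<noteq> n" for l i
  proof -
    \<comment> \<open>An off-diagonal index exists only for \<open>n > 0\<close>, which excludes
      \<open>j = 1\<close>.\<close>
    have "j = k" using that assms(4) j by auto
    then have "k < Suc i + 0 \<or> k < Suc (2 * n - i) + 0" using that j by linarith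
    then have "coeff2 (F l) (Suc i) 0 = 0 \<or> coeff2 (F l) (Suc (2 * n - i)) 0 = 0"
      using degree_leD[OF degree] not_le by blast
    then show ?thesis unfolding t_def by (elim disjE) simp_all
  qed
  have "(\<Sum>i\<le>2 * n. t l i) = of_nat (j * j) * (coeff2 (F l) j 0)\<^sup>2" for l
  proof -
    have "(\<Sum>i\<le>2 * n. t l i) = (\<Sum>i\<le>2 * n. if i = n then t l n else 0)"
      using off_diagonal by (intro sum.cong) auto
    also have "\<dots> = t l n" by simp
    also have "\<dots> = of_nat (j * j) * (coeff2 (F l) j 0)\<^sup>2"
      unfolding t_def j power2_eq_square by simp
    finally show ?thesis .
  qed
  moreover have "coeff2 (\<Sum>l\<in>UNIV. dz (F l) * dz (F l)) (2 * n) 0 = (\<Sum>l\<in>UNIV. \<Sum>i\<le>2 * n. t l i)"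
    unfolding coeff2_sum_dz_mult t_def by simp
  ultimately have "of_nat (j * j) * (\<Sum>l\<in>UNIV. (coeff2 (F l) j 0)\<^sup>2) = 0"
    using isotropic by (simp only: sum_distrib_left coeff_0)
  then show ?thesis unfolding j mult_eq_0_iff of_nat_eq_0_iff by simp
qed

section \<open>From conformality to isotropy, and the conclusion for the surface\<close>

lemma conformal_imp_isotropic:
  fixes X :: "real \<times> real \<Rightarrow> real ^ 'n"
  assumes X: "\<And>x y l. of_real (X (x, y) $ l) = zeval (F l) (Complex x y)"
    and "conformal X"
  shows "(\<Sum>l\<in>UNIV. dz (F l) * dz (F l)) = 0"
proof (rule zeval_eq_0_imp_eq_0)
  fix z
  obtain x y where z: "z = Complex x y" by (cases z)
  let ?f = "\<lambda>l u. X u $ l"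
  define Xx Xy where "Xx l = partial_x (?f l) (x, y)" and "Xy l = partial_y (?f l) (x, y)" for l
  note D = zeval_partial_derivatives[of "?f l" "F l" for l, OF X]
  \<comment> \<open>Writing a curve as a sum of its components times axis vectors turns
    componentwise derivatives into a derivative of the vector.\<close>
  have vec: "(g has_vector_derivative (\<chi> l. d l)) (at s)"
    if "\<And>l. ((\<lambda>t. g t $ l) has_vector_derivative d l) (at s)"
    for g :: "real \<Rightarrow> real ^ 'n" and d s
  proof -
    have "((\<lambda>t. \<Sum>l\<in>UNIV. g t $ l *\<^sub>R (axis l 1 :: real ^ 'n)) has_vector_derivative
        (\<Sum>l\<in>UNIV. d l *\<^sub>R axis l 1)) (at s)"
      by (intro has_vector_derivative_sum
          bounded_linear.has_vector_derivative[OF bounded_linear_scaleR_left] that)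
    moreover have axis_sum: "(\<Sum>l\<in>UNIV. c l *\<^sub>R (axis l 1 :: real ^ 'n)) = (\<chi> l. c l)" for c :: "'n \<Rightarrow> real"
      by (simp add: vec_eq_iff axis_def if_distrib if_distribR cong: if_cong)
    ultimately show ?thesis by (simp only: axis_sum vec_lambda_eta)
  qed
  have partials: "partial_x X (x, y) = (\<chi> l. Xx l)" "partial_y X (x, y) = (\<chi> l. Xy l)"
    unfolding partial_x_def[of X] partial_y_def[of X] Xx_def Xy_def
    by (simp_all add: vector_derivative_at vec D(1,2))
  have conf: "(\<Sum>l\<in>UNIV. Xx l * Xx l) - (\<Sum>l\<in>UNIV. Xy l * Xy l) = 0" "(\<Sum>l\<in>UNIV. Xx l * Xy l) = 0"
    using \<open>conformal X\<close>[unfolded conformal_def, rule_format, of "(x, y)"]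
    by (simp_all add: partials inner_vec_def)
  \<comment> \<open>Since 2 dX/dz = X_x - i X_y, four times the bilinear square of dX/dz has real
    part |X_x|^2 - |X_y|^2 and imaginary part -2 X_x . X_y: exactly the two conformality
    conditions.\<close>
  have dz: "2 * zeval (dz (F l)) z = of_real (Xx l) - \<i> * of_real (Xy l)" for l
    unfolding Xx_def Xy_def D(3,4) z zeval_smult zeval_add zeval_diff by (simp add: algebra_simps)
  have "4 * zeval (\<Sum>l\<in>UNIV. dz (F l) * dz (F l)) z
      = (\<Sum>l\<in>UNIV. (2 * zeval (dz (F l)) z) * (2 * zeval (dz (F l)) z))"
    by (simp add: zeval_sum zeval_mult sum_distrib_left)
  also have "\<dots> = (\<Sum>l\<in>UNIV. of_real (Xx l * Xx l - Xy l * Xy l) - 2 * \<i> * of_real (Xx l * Xy l))"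
    unfolding dz by (intro sum.cong refl) (simp add: complex_eq_iff)
  also have "\<dots> = of_real ((\<Sum>l\<in>UNIV. Xx l * Xx l) - (\<Sum>l\<in>UNIV. Xy l * Xy l))
      - 2 * \<i> * of_real (\<Sum>l\<in>UNIV. Xx l * Xy l)"
    by (simp only: sum_subtractf of_real_diff of_real_sum sum_distrib_left)
  also have "\<dots> = 0" unfolding conf by simp
  finally show "zeval (\<Sum>l\<in>UNIV. dz (F l) * dz (F l)) z = 0" by simp
qed

theorem theorem3:
  fixes X :: "real \<times> real \<Rightarrow> real ^ 'n" and k :: nat
  assumes "CARD('n) \<ge> 2"
    and "k \<ge> 1"
    and "polynomial_surface k X"
    and "conformal X"
  shows "(\<forall>l z. laplacian (\<lambda>u. X u $ l) z = 0) \<and>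
    (\<exists>v w :: nat \<Rightarrow> real ^ 'n.
       (\<forall>r \<theta>. r \<ge> 0 \<longrightarrow>
          X (r * cos \<theta>, r * sin \<theta>) =
            (\<Sum>i\<le>k. r ^ i *\<^sub>R (sin (real i * \<theta>) *\<^sub>R v i + cos (real i * \<theta>) *\<^sub>R w i))) \<and>
       (\<forall>x y. X (x, y) =
            (\<Sum>i\<le>k. Re (Complex x y ^ i) *\<^sub>R w i + Im (Complex x y ^ i) *\<^sub>R v i)) \<and>
       (\<forall>j\<in>{k, 1}. norm (v j) = norm (w j) \<and> v j \<bullet> w j = 0))"
proof -
  obtain P where P: "\<And>z l. X z $ l = bipoly (P l) z"
    and k: "k = Max (range (\<lambda>l. total_degree (P l)))"
    using assms(3) unfolding polynomial_surface_def by blast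
  have "\<exists>F. (\<forall>x y. of_real (X (x, y) $ l) = zeval F (Complex x y)) \<and> hermitian F \<and> degree_le k F"
    for l
  proof -
    obtain F where F: "\<And>x y. of_real (bipoly (P l) (x, y)) = zeval F (Complex x y)"
      "hermitian F" "degree_le (total_degree (P l)) F"
      using bipoly_eq_zeval by blast
    have "total_degree (P l) \<le> k" unfolding k by (intro Max_ge) auto
    then have "degree_le k F" using F(3) unfolding degree_le_def using le_trans by blast
    then show ?thesis using F P by auto
  qed
  then obtain F where X: "\<And>x y l. of_real (X (x, y) $ l) = zeval (F l) (Complex x y)"
    and herm: "\<And>l. hermitian (F l)" and degree: "\<And>l. degree_le k (F l)"
    by metis
  note isotropic = conformal_imp_isotropic[OF X assms(4)]
  note harmonic = isotropic_imp_harmonic[OF degree herm isotropic]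
  have laplace: "laplacian (\<lambda>u. X u $ l) z = 0" for l z
  proof -
    have "dz (dzbar (F l)) = 0"
      by (intro poly_eqI) (simp only: coeff2_dz coeff2_dzbar, simp add: harmonic)
    then have "complex_of_real (laplacian (\<lambda>u. X u $ l) (fst z, snd z)) = 0"
      by (subst laplacian_zeval[OF X]) simp
    then show ?thesis by simp
  qed
  \<comment> \<open>Read off from \<open>zeval_harmonic\<close>. The value of \<open>v 0\<close> is
    immaterial, since it is multiplied by Im(z^0) = 0.\<close>
  define v w :: "nat \<Rightarrow> real ^ 'n"
    where "v i = (\<chi> l. if i = 0 then 0 else - 2 * Im (coeff2 (F l) i 0))"
      and "w i = (\<chi> l. if i = 0 then Re (coeff2 (F l) 0 0) else 2 * Re (coeff2 (F l) i 0))" for i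
  have cartesian: "X (x, y) = (\<Sum>i\<le>k. Re (Complex x y ^ i) *\<^sub>R w i + Im (Complex x y ^ i) *\<^sub>R v i)"
    for x y
  proof (rule vec_eq_iff[THEN iffD2], rule allI)
    fix l
    have "complex_of_real (X (x, y) $ l) = of_real
        ((\<Sum>i\<le>k. Re (Complex x y ^ i) *\<^sub>R w i + Im (Complex x y ^ i) *\<^sub>R v i) $ l)"
      unfolding X by (subst zeval_harmonic[OF degree herm]) (simp_all add: harmonic v_def w_def)
    then show "X (x, y) $ l
        = (\<Sum>i\<le>k. Re (Complex x y ^ i) *\<^sub>R w i + Im (Complex x y ^ i) *\<^sub>R v i) $ l"
      by (simp only: of_real_eq_iff)
  qed
  have polar: "X (r * cos \<theta>, r * sin \<theta>) =
      (\<Sum>i\<le>k. r ^ i *\<^sub>R (sin (real i * \<theta>) *\<^sub>R v i + cos (real i * \<theta>) *\<^sub>R w i))" for r \<theta>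
  proof -
    have "Complex (r * cos \<theta>) (r * sin \<theta>) = rcis r \<theta>" by (simp add: complex_eq_iff)
    then have "Complex (r * cos \<theta>) (r * sin \<theta>) ^ i = rcis (r ^ i) (real i * \<theta>)" for i
      by (simp add: DeMoivre2)
    then show ?thesis unfolding cartesian by (simp add: scaleR_add_right add.commute)
  qed
  have extreme: "norm (v j) = norm (w j) \<and> v j \<bullet> w j = 0" if j: "j \<in> {k, 1}" for j
  proof -
    \<comment> \<open>With c = (w - i v) / 2, the sum of squares of c is (|w|^2 - |v|^2 - 2i v . w)
      / 4. Its real and imaginary parts give the two claims.\<close>
    let ?c = "\<lambda>l. coeff2 (F l) j 0"
    have "j \<noteq> 0" using j assms(2) by auto
    have sum_0: "(\<Sum>l\<in>UNIV. (?c l)\<^sup>2) = 0"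
      using isotropic_extreme_coeffs[OF degree isotropic assms(2) j] .
    have "Re (\<Sum>l\<in>UNIV. (?c l)\<^sup>2) = 0" "Im (\<Sum>l\<in>UNIV. (?c l)\<^sup>2) = 0"
      unfolding sum_0 by simp_all
    then have re: "(\<Sum>l\<in>UNIV. Re (?c l) * Re (?c l)) = (\<Sum>l\<in>UNIV. Im (?c l) * Im (?c l))"
      and im: "(\<Sum>l\<in>UNIV. Im (?c l) * Re (?c l)) = 0"
      by (simp_all add: power2_eq_square sum_subtractf mult_ac flip: sum_distrib_left)
    have "v j \<bullet> v j = 4 * (\<Sum>l\<in>UNIV. Im (?c l) * Im (?c l))"
      and "w j \<bullet> w j = 4 * (\<Sum>l\<in>UNIV. Re (?c l) * Re (?c l))"
      and "v j \<bullet> w j = - 4 * (\<Sum>l\<in>UNIV. Im (?c l) * Re (?c l))"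
      using \<open>j \<noteq> 0\<close> by (simp_all add: v_def w_def inner_vec_def sum_distrib_left sum_negf mult_ac)
    then show ?thesis using re im by (simp add: norm_eq_sqrt_inner)
  qed
  show ?thesis using laplace polar cartesian extreme by blast
qed

end
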